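(* Let $k\ge 2$, let $A$ be a finite alphabet, and let $\tau:\Sigma_k^*\to A$ be a labeled $k$-tree with complexity function $p_\tau$. Then $$h(\tau)=\lim_{n\to\infty}\frac{\log p_\tau(n)}{1+k+\dots+k^n}=\inf\left\{\frac{\log p_\tau(n)}{1+k+\dots+k^n}: n\in\mathbb N\right\}.$$
   Context: For $k\ge 2$ let $\Sigma_k=\{0,1,\dots,k-1\}$ and let $\Sigma_k^*$ be the set of all finite words on $\Sigma_k$ (the $k$-tree), whose root is the empty word $\epsilon$; the children of the node $w$ are the nodes $ws$, $s\in\Sigma_k$. A labeled tree is a function $\tau:\Sigma_k^*\to A$, where $A$ is a finite alphabet. For $n\ge 0$, $\Delta_n=\bigcup_{0\le i\le n}\Sigma_k^i$ is the set of words of length at most $n$, so $|\Delta_n|=1+k+\dots+k^n$. An $n$-block is a function $B:\Delta_n\to A$; it appears in $\tau$ if there is $x\in\Sigma_k^*$ with $\tau(xw)=B(w)$ for all $w\in\Delta_n$. The complexity function $p_\tau(n)$ is the number of $n$-blocks that appear in $\tau$. The topological entropy of $\tau$ is $h(\tau)=\lim_{n\to\infty}\log p_\tau(n)/|\Delta_n|$; the existence of this limit is known from earlier work. *)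

theory Defs
  imports Complex_Main "HOL-Library.FuncSet"
begin

definition words :: "nat \<Rightarrow> nat list set" where
  "words k = lists {..<k}"

definition \<Delta> :: "nat \<Rightarrow> nat \<Rightarrow> nat list set" where
  "\<Delta> k n = {w \<in> words k. length w \<le> n}"

text \<open>A labeled tree is a function on all of \<^typ>\<open>nat list\<close>; only its values on
  \<^term>\<open>words k\<close> matter below. Blocks are extensional functions (undefined outside
  \<^term>\<open>\<Delta> k n\<close>), so that they can be counted.\<close>

definition labeled_tree :: "nat \<Rightarrow> 'a set \<Rightarrow> (nat list \<Rightarrow> 'a) \<Rightarrow> bool" where
  "labeled_tree k A \<tau> \<longleftrightarrow> \<tau> \<in> words k \<rightarrow> A"

definition blocks :: "nat \<Rightarrow> 'a set \<Rightarrow> nat \<Rightarrow> (nat list \<Rightarrow> 'a) set" where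
  "blocks k A n = \<Delta> k n \<rightarrow>\<^sub>E A"

definition appears :: "nat \<Rightarrow> nat \<Rightarrow> (nat list \<Rightarrow> 'a) \<Rightarrow> (nat list \<Rightarrow> 'a) \<Rightarrow> bool" where
  "appears k n B \<tau> \<longleftrightarrow> (\<exists>x \<in> words k. \<forall>w \<in> \<Delta> k n. \<tau> (x @ w) = B w)"

definition complexity :: "nat \<Rightarrow> 'a set \<Rightarrow> (nat list \<Rightarrow> 'a) \<Rightarrow> nat \<Rightarrow> nat" where
  "complexity k A \<tau> n = card {B \<in> blocks k A n. appears k n B \<tau>}"

definition entropy :: "nat \<Rightarrow> 'a set \<Rightarrow> (nat list \<Rightarrow> 'a) \<Rightarrow> real" where
  "entropy k A \<tau> = lim (\<lambda>n. ln (real (complexity k A \<tau> n)) / real (card (\<Delta> k n)))"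

end

theory Submission
  imports Defs
begin

text \<open>Cutting a tree of height \<open>a + b\<close> below its first \<open>a\<close> levels leaves \<open>k ^ a\<close> subtrees of
  height \<open>b\<close>. So if \<open>f n\<close> is the logarithm of the number of blocks with \<open>n\<close> levels, and \<open>s n\<close> the
  number of nodes of such a block, then \<open>f (a + b) \<le> f a + k ^ a * f b\<close> and
  \<open>s (a + b) = s a + k ^ a * s b\<close>. A Fekete argument applies when the remainder of the division
  \<open>n = q * m + r\<close> is placed at the root: the top \<open>r\<close> levels then contribute a bounded amount,
  whereas at the leaves they would contribute a positive fraction of all nodes.\<close>

lemma weighted_fekete:
  fixes f s c :: "nat \<Rightarrow> real"
  assumes f0: "f 0 = 0" and f_nonneg: "\<And>n. f n \<ge> 0" and c_nonneg: "\<And>n. c n \<ge> 0"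
    and f_add: "\<And>a b. f (a + b) \<le> f a + c a * f b"
    and s_add: "\<And>a b. s (a + b) = s a + c a * s b"
    and s_nonneg: "\<And>n. s n \<ge> 0" and s_pos: "\<And>n. s (Suc n) > 0"
    and s_top: "filterlim s at_top sequentially"
  shows "(\<lambda>n. f (Suc n) / s (Suc n)) \<longlonglongrightarrow> (INF n. f (Suc n) / s (Suc n))"
proof -
  define g where "g n = f (Suc n) / s (Suc n)" for n
  have g_nonneg: "g n \<ge> 0" for n
    by (simp add: g_def f_nonneg s_nonneg)
  then have bdd: "bdd_below (range g)"
    by (intro bdd_belowI2)
  have lower: "(INF n. g n) \<le> g n" for n
    by (rule cINF_lower[OF bdd]) simp
  \<comment> \<open>Each induction step peels \<open>Suc m\<close> levels off the root. The ratio
    survives because \<open>f_add\<close> and \<open>s_add\<close> carry the same weight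
    \<open>c (Suc m)\<close>.\<close>
  have multiple: "f (q * Suc m) \<le> s (q * Suc m) * g m" for q m
  proof (induction q)
    case 0
    show ?case by (simp add: f0 s_nonneg g_nonneg)
  next
    case (Suc q)
    have "f (Suc q * Suc m) \<le> f (Suc m) + c (Suc m) * f (q * Suc m)"
      unfolding mult_Suc by (rule f_add)
    also have "\<dots> \<le> s (Suc m) * g m + c (Suc m) * (s (q * Suc m) * g m)"
      using s_pos[of m] Suc c_nonneg[of "Suc m"]
      by (intro add_mono mult_left_mono) (simp_all add: g_def)
    also have "\<dots> = s (Suc q * Suc m) * g m"
      unfolding mult_Suc s_add by (simp only: algebra_simps)
    finally show ?case .
  qed
  \<comment> \<open>A bound for \<open>f r\<close> that serves every remainder
    \<open>r \<le> m\<close> at once and does not depend on \<open>n\<close>.\<close>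
  define C where "C m = (\<Sum>r\<le>m. f r)" for m
  have upper: "g n \<le> C m / s (Suc n) + g m" for m n
  proof -
    define r q where "r = Suc n mod Suc m" and "q = Suc n div Suc m"
    have split: "Suc n = r + q * Suc m"
      unfolding r_def q_def by (rule mod_div_mult_eq[symmetric])
    have "r \<le> m"
      unfolding r_def less_Suc_eq_le[symmetric] by (rule mod_less_divisor) simp
    then have "f r \<le> C m"
      unfolding C_def by (intro member_le_sum) (auto simp: f_nonneg)
    have "f (Suc n) \<le> f r + c r * f (q * Suc m)"
      unfolding split by (rule f_add)
    also have "\<dots> \<le> C m + c r * (s (q * Suc m) * g m)"
      using \<open>f r \<le> C m\<close> multiple[of q m] c_nonneg by (intro add_mono mult_left_mono)
    \<comment> \<open>The nonnegative term \<open>s r * g m\<close> is added so that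
      \<open>s_add\<close> can recombine the bracket into \<open>s (Suc n)\<close>.\<close>
    also have "\<dots> \<le> C m + (s r + c r * s (q * Suc m)) * g m"
      using s_nonneg[of r] g_nonneg[of m] by (simp add: algebra_simps)
    also have "\<dots> = C m + s (Suc n) * g m"
      unfolding split s_add ..
    finally show ?thesis
      using s_pos[of n] by (simp add: g_def[of n] field_simps)
  qed
  have "g \<longlonglongrightarrow> (INF n. g n)"
  proof (rule order_tendstoI)
    fix x assume "x < (INF n. g n)"
    then show "\<forall>\<^sub>F n in sequentially. x < g n"
      using lower by (intro always_eventually) (metis less_le_trans)
  next
    fix x assume "(INF n. g n) < x"
    then obtain m where m: "g m < x"
      by (auto simp: cINF_less_iff bdd)
    \<comment> \<open>Since \<open>m\<close> is fixed before \<open>n\<close> grows,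
      \<open>C m\<close> is a constant here and the contribution of the top levels dies out.\<close>
    have "(\<lambda>n. C m / s (Suc n)) \<longlonglongrightarrow> 0"
      by (intro real_tendsto_divide_at_top[OF tendsto_const]
          filterlim_compose[OF s_top filterlim_Suc])
    then have "\<forall>\<^sub>F n in sequentially. C m / s (Suc n) < x - g m"
      using m by (intro order_tendstoD(2)) auto
    then show "\<forall>\<^sub>F n in sequentially. g n < x"
      by (rule eventually_mono) (smt (verit) upper)
  qed
  then show ?thesis
    unfolding g_def .
qed

definition block_at :: "nat \<Rightarrow> (nat list \<Rightarrow> 'a) \<Rightarrow> nat \<Rightarrow> nat list \<Rightarrow> nat list \<Rightarrow> 'a" where
  "block_at k \<tau> n x = restrict (\<lambda>w. \<tau> (x @ w)) (\<Delta> k n)"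

lemma append_words [intro]: "x \<in> words k \<Longrightarrow> y \<in> words k \<Longrightarrow> x @ y \<in> words k"
  by (simp add: words_def)

lemma Delta_eq: "\<Delta> k n = {w. set w \<subseteq> {..<k} \<and> length w \<le> n}"
  by (auto simp: \<Delta>_def words_def)

lemma finite_Delta: "finite (\<Delta> k n)"
  by (simp add: Delta_eq finite_lists_length_le)

lemma card_Delta: "card (\<Delta> k n) = (\<Sum>i\<le>n. k ^ i)"
  by (simp add: Delta_eq card_lists_length_le)

text \<open>A block is extensional, so its position \<open>x\<close> determines it completely.
  Counting appearing blocks thus becomes counting the image of a map on positions.\<close>

lemma appearing_blocks_eq:
  assumes "labeled_tree k A \<tau>"
  shows "{B \<in> blocks k A n. appears k n B \<tau>} = block_at k \<tau> n ` words k"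
proof (intro equalityI subsetI)
  fix B assume B: "B \<in> {B \<in> blocks k A n. appears k n B \<tau>}"
  then obtain x where x: "x \<in> words k" "\<And>w. w \<in> \<Delta> k n \<Longrightarrow> \<tau> (x @ w) = B w"
    by (auto simp: appears_def)
  have "B = block_at k \<tau> n x"
    using B x(2) by (auto simp: blocks_def block_at_def PiE_def extensional_def restrict_def)
  then show "B \<in> block_at k \<tau> n ` words k"
    using x(1) by blast
next
  fix B assume "B \<in> block_at k \<tau> n ` words k"
  then obtain x where x: "x \<in> words k" and B: "B = block_at k \<tau> n x"
    by blast
  have "B \<in> blocks k A n"
    using assms x unfolding B blocks_def block_at_def labeled_tree_def
    by (auto simp: \<Delta>_def)
  moreover have "appears k n B \<tau>"
    using x unfolding B appears_def block_at_def by auto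
  ultimately show "B \<in> {B \<in> blocks k A n. appears k n B \<tau>}"
    by simp
qed

lemma complexity_eq:
  "labeled_tree k A \<tau> \<Longrightarrow> complexity k A \<tau> n = card (block_at k \<tau> n ` words k)"
  by (simp add: complexity_def appearing_blocks_eq)

lemma finite_block_at:
  assumes "finite A" "labeled_tree k A \<tau>"
  shows "finite (block_at k \<tau> n ` words k)"
proof -
  have "finite (blocks k A n)"
    unfolding blocks_def using assms(1) by (intro finite_PiE finite_Delta)
  then show ?thesis
    unfolding appearing_blocks_eq[OF assms(2), symmetric] by simp
qed

text \<open>The block at the empty word always appears. Positivity makes the logarithms below
  nonnegative and monotone.\<close>

lemma complexity_pos:
  assumes "finite A" "labeled_tree k A \<tau>"
  shows "complexity k A \<tau> n > 0"
  using finite_block_at[OF assms, of n]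
  by (auto simp: complexity_eq[OF assms(2)] card_gt_0_iff words_def)

text \<open>The index of a block is its height, one less than its number of levels; hence
  \<open>Suc (a + b)\<close> on the left. The cut leaves a top of height \<open>a\<close> and one
  subtree of height \<open>b\<close> under each of the \<open>k ^ Suc a\<close> words of length
  \<open>Suc a\<close>.\<close>

lemma complexity_add:
  assumes "finite A" "labeled_tree k A \<tau>"
  shows "complexity k A \<tau> (Suc (a + b)) \<le> complexity k A \<tau> a * complexity k A \<tau> b ^ (k ^ Suc a)"
proof -
  define W where "W = {u. set u \<subseteq> {..<k} \<and> length u = Suc a}"
  define P where "P n = block_at k \<tau> n ` words k" for n
  \<comment> \<open>\<open>\<Phi>\<close> records the top of a block and the family of its lower
    subtrees, indexed by their roots in \<open>W\<close>.\<close>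
  define \<Phi> where "\<Phi> = (\<lambda>B :: nat list \<Rightarrow> 'a.
    (restrict B (\<Delta> k a), \<lambda>u\<in>W. \<lambda>w\<in>\<Delta> k b. B (u @ w)))"
  have W_words: "u \<in> words k" if "u \<in> W" for u
    using that by (auto simp: W_def words_def)
  have WD: "u @ w \<in> \<Delta> k (Suc (a + b))" if "u \<in> W" "w \<in> \<Delta> k b" for u w
    using that by (auto simp: W_def Delta_eq)
  \<comment> \<open>No node is lost: a word of length at most \<open>a\<close> lies in the top, and
    a longer one splits after \<open>Suc a\<close> letters into a root in \<open>W\<close> and a
    word in \<open>\<Delta> k b\<close>.\<close>
  have "inj_on \<Phi> (P (Suc (a + b)))"
  proof (rule inj_onI)
    fix B B' assume "B \<in> P (Suc (a + b))" "B' \<in> P (Suc (a + b))" and eq: "\<Phi> B = \<Phi> B'"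
    then have ext: "B \<in> extensional (\<Delta> k (Suc (a + b)))" "B' \<in> extensional (\<Delta> k (Suc (a + b)))"
      by (auto simp: P_def block_at_def)
    show "B = B'"
    proof (rule extensionalityI[OF ext])
      fix v assume v: "v \<in> \<Delta> k (Suc (a + b))"
      show "B v = B' v"
      proof (cases "length v \<le> a")
        case True
        then have "v \<in> \<Delta> k a"
          using v by (simp add: \<Delta>_def)
        then show ?thesis
          using fun_cong[OF arg_cong[OF eq, of fst], of v] by (simp add: \<Phi>_def)
      next
        case False
        then have u: "take (Suc a) v \<in> W" and w: "drop (Suc a) v \<in> \<Delta> k b"
          using v by (auto simp: W_def Delta_eq dest: in_set_takeD in_set_dropD)
        have "snd (\<Phi> B) (take (Suc a) v) (drop (Suc a) v)
            = snd (\<Phi> B') (take (Suc a) v) (drop (Suc a) v)"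
          by (simp only: eq)
        with u w show ?thesis
          by (simp add: \<Phi>_def)
      qed
    qed
  qed
  \<comment> \<open>The pieces again appear in \<open>\<tau>\<close>: the top at the same position
    \<open>x\<close>, the subtree under \<open>u\<close> at \<open>x @ u\<close>.\<close>
  moreover have "\<Phi> ` P (Suc (a + b)) \<subseteq> P a \<times> (W \<rightarrow>\<^sub>E P b)"
  proof (rule image_subsetI)
    fix B assume "B \<in> P (Suc (a + b))"
    then obtain x where x: "x \<in> words k" and B: "B = block_at k \<tau> (Suc (a + b)) x"
      by (auto simp: P_def)
    have "restrict B (\<Delta> k a) = block_at k \<tau> a x"
      by (auto simp: B block_at_def \<Delta>_def restrict_def)
    moreover have "(\<lambda>w\<in>\<Delta> k b. B (u @ w)) = block_at k \<tau> b (x @ u)" if "u \<in> W" for u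
      using WD[OF that] by (auto simp: B block_at_def restrict_def)
    ultimately show "\<Phi> B \<in> P a \<times> (W \<rightarrow>\<^sub>E P b)"
      using x W_words by (auto simp: \<Phi>_def P_def)
  qed
  moreover have finW: "finite W"
    unfolding W_def by (rule finite_lists_length_eq) simp
  then have "finite (P a \<times> (W \<rightarrow>\<^sub>E P b))"
    unfolding P_def using finite_block_at[OF assms] by (intro finite_cartesian_product finite_PiE)
  ultimately have "card (P (Suc (a + b))) \<le> card (P a \<times> (W \<rightarrow>\<^sub>E P b))"
    by (intro card_inj_on_le)
  moreover have "card W = k ^ Suc a"
    unfolding W_def by (subst card_lists_length_eq) simp_all
  ultimately show ?thesis
    using finW by (simp add: complexity_eq[OF assms(2)] P_def card_cartesian_product card_PiE)
qed

theorem theorem2p1: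
  fixes k :: nat and A :: "'a set" and \<tau> :: "nat list \<Rightarrow> 'a"
  assumes "k \<ge> 2" and "finite A" and "labeled_tree k A \<tau>"
  shows "(\<lambda>n. ln (real (complexity k A \<tau> n)) / (\<Sum>i\<le>n. real k ^ i)) \<longlonglongrightarrow> entropy k A \<tau>
    \<and> entropy k A \<tau> = (INF n. ln (real (complexity k A \<tau> n)) / (\<Sum>i\<le>n. real k ^ i))"
proof -
  \<comment> \<open>The shift passes from heights to numbers of levels, which add up without an
    offset. The value 0 at \<open>n = 0\<close> belongs to the empty block, and
    \<open>f (Suc n)\<close> to height \<open>n\<close>.\<close>
  define f where "f n = (case n of 0 \<Rightarrow> 0 | Suc m \<Rightarrow> ln (real (complexity k A \<tau> m)))" for n
  define s where "s n = (\<Sum>i<n. real k ^ i)" for n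
  note pos = complexity_pos[OF assms(2,3)]
  have "(\<lambda>n. f (Suc n) / s (Suc n)) \<longlonglongrightarrow> (INF n. f (Suc n) / s (Suc n))"
  proof (rule weighted_fekete[where c = "\<lambda>n. real k ^ n"])
    show "f 0 = 0"
      by (simp add: f_def)
    show "f n \<ge> 0" for n
      using pos by (auto simp: f_def Suc_le_eq split: nat.split)
    show "real k ^ n \<ge> 0" for n
      by simp
    show "f (a + b) \<le> f a + real k ^ a * f b" for a b
    proof (cases "a = 0 \<or> b = 0")
      case True
      then show ?thesis by (auto simp: f_def)
    next
      case False
      then obtain a' b' where ab: "a = Suc a'" "b = Suc b'"
        by (metis not0_implies_Suc)
      have "real (complexity k A \<tau> (Suc (a' + b')))
          \<le> real (complexity k A \<tau> a') * real (complexity k A \<tau> b') ^ (k ^ Suc a')"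
        using complexity_add[OF assms(2,3), of a' b'] by (metis of_nat_le_iff of_nat_mult of_nat_power)
      then have "ln (real (complexity k A \<tau> (Suc (a' + b'))))
          \<le> ln (real (complexity k A \<tau> a') * real (complexity k A \<tau> b') ^ (k ^ Suc a'))"
        using pos by (intro ln_mono) auto
      also have "\<dots> = ln (real (complexity k A \<tau> a'))
          + real k ^ Suc a' * ln (real (complexity k A \<tau> b'))"
        using pos[of a'] pos[of b'] by (subst ln_mult_pos) (simp_all add: ln_realpow)
      finally show ?thesis
        by (simp add: f_def ab)
    qed
    show "s (a + b) = s a + real k ^ a * s b" for a b
      by (induction b) (simp_all add: s_def power_add algebra_simps)
    show "s n \<ge> 0" for n
      by (simp add: s_def sum_nonneg)
    show "s (Suc n) > 0" for n
      using assms(1) unfolding s_def by (intro sum_pos) auto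
    \<comment> \<open>Each of the \<open>n\<close> summands is at least 1.\<close>
    have "real n \<le> s n" for n
      using assms(1) sum_mono[of "{..<n}" "\<lambda>_. 1" "\<lambda>i. real k ^ i"] by (simp add: s_def)
    then show "filterlim s at_top sequentially"
      by (intro filterlim_at_top_mono[OF filterlim_real_sequentially] always_eventually) auto
  qed
  then have lim: "(\<lambda>n. ln (real (complexity k A \<tau> n)) / (\<Sum>i\<le>n. real k ^ i))
      \<longlonglongrightarrow> (INF n. ln (real (complexity k A \<tau> n)) / (\<Sum>i\<le>n. real k ^ i))"
    by (simp only: f_def s_def nat.case lessThan_Suc_atMost)
  \<comment> \<open>\<open>lim\<close> is a total operator, so its value is known only now that
    convergence is established.\<close>
  have "entropy k A \<tau> = (INF n. ln (real (complexity k A \<tau> n)) / (\<Sum>i\<le>n. real k ^ i))"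
    using limI[OF lim] by (simp add: entropy_def card_Delta)
  with lim show ?thesis
    by simp
qed

end
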